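(* Let $n\geq 3$ and let $f\in F(n)$ be neither a constant function nor the identity. Then there exists $h\in F(n)$ with $h\sim f$ such that $\mathcal{A}(h)$ and $\mathcal{A}(f)$ are not isomorphic.
   Context: $F(n)$ is the set of all functions $f:\{0,1\}^n\to\{0,1\}^n$, written $f=(f_1,\dots,f_n)$. For $i\in[n]$, $e_i$ is the configuration with a $1$ exactly in component $i$; addition is componentwise modulo $2$. The asynchronous graph $\mathcal{A}(f)$ is the digraph on $\{0,1\}^n$ with an arc from $x$ to $x+e_i$ whenever $f_i(x)\neq x_i$. The synchronous graph $\mathcal{S}(f)$ has an arc from $x$ to $f(x)$ for every $x$. $f\sim h$ means $\mathcal{S}(f)$ and $\mathcal{S}(h)$ are isomorphic digraphs. *)

theory Defs
  imports
    "HOL-Analysis.Finite_Cartesian_Product"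
    "HOL-Library.Z2"
    "Graph_Theory.Graph_Theory"
begin

text \<open>
  Configurations are vectors over the two-element field \<open>bit\<close>, so that vector addition is
  componentwise addition modulo 2. The index set \<open>[n]\<close> is a finite type \<open>'n\<close> with
  \<open>n = CARD('n)\<close>.
\<close>

type_synonym 'n config = "(bit, 'n) vec"

instance bit :: finite
proof
  have "(UNIV :: bit set) = {0, 1}"
    using bit_not_zero_iff by blast
  then show "finite (UNIV :: bit set)"
    by (metis finite.emptyI finite_insert)
qed

definition async_graph :: "('n config \<Rightarrow> 'n config) \<Rightarrow> ('n::finite) config pair_pre_digraph" where
  "async_graph f =
     \<lparr> pverts = UNIV, parcs = {(x, x + axis i 1) | x i. f x $ i \<noteq> x $ i} \<rparr>"

definition sync_graph :: "('n config \<Rightarrow> 'n config) \<Rightarrow> ('n::finite) config pair_pre_digraph" where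
  "sync_graph f = \<lparr> pverts = UNIV, parcs = {(x, f x) | x. True} \<rparr>"

definition sync_equiv ::
    "('n config \<Rightarrow> 'n config) \<Rightarrow> (('n::finite) config \<Rightarrow> 'n config) \<Rightarrow> bool" (infix "\<sim>\<^sub>S" 50) where
  "f \<sim>\<^sub>S h \<longleftrightarrow> digraph_iso (with_proj (sync_graph f)) (with_proj (sync_graph h))"

text \<open>
  For digraphs without parallel arcs, isomorphism in the sense of \<open>digraph_iso\<close> (which also
  carries an arc map) amounts to a bijection of the vertices that preserves and reflects arcs.
\<close>

lemma digraph_iso_with_proj_iff:
  fixes G :: "'a pair_pre_digraph" and H :: "'b pair_pre_digraph"
  assumes "parcs G \<subseteq> pverts G \<times> pverts G" "parcs H \<subseteq> pverts H \<times> pverts H"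
  shows "digraph_iso (with_proj G) (with_proj H) \<longleftrightarrow>
    (\<exists>\<phi>. bij_betw \<phi> (pverts G) (pverts H) \<and>
      (\<forall>x\<in>pverts G. \<forall>y\<in>pverts G. (x, y) \<in> parcs G \<longleftrightarrow> (\<phi> x, \<phi> y) \<in> parcs H))"
    (is "?L \<longleftrightarrow> ?R")
proof
  assume ?L
  then obtain k where k: "pre_digraph.digraph_isomorphism (with_proj G) k"
    and H: "with_proj H = app_iso k (with_proj G)"
    unfolding digraph_iso_def by blast
  have eqs: "pverts H = iso_verts k ` pverts G" "parcs H = iso_arcs k ` parcs G"
    "iso_tail k = fst" "iso_head k = snd"
    using H by (auto simp: with_proj_def app_iso_def)
  have inj: "inj_on (iso_verts k) (pverts G)"
    and arc: "\<And>a. a \<in> parcs G \<Longrightarrow> iso_arcs k a = (iso_verts k (fst a), iso_verts k (snd a))"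
    using k eqs by (auto simp: pre_digraph.digraph_isomorphism_def prod_eq_iff)
  have "(x, y) \<in> parcs G \<longleftrightarrow> (iso_verts k x, iso_verts k y) \<in> parcs H"
    if "x \<in> pverts G" "y \<in> pverts G" for x y
  proof
    assume "(x, y) \<in> parcs G"
    then show "(iso_verts k x, iso_verts k y) \<in> parcs H"
      using arc eqs(2) by (metis fst_conv image_eqI snd_conv)
  next
    assume "(iso_verts k x, iso_verts k y) \<in> parcs H"
    then obtain a where a: "a \<in> parcs G" "iso_arcs k a = (iso_verts k x, iso_verts k y)"
      using eqs(2) by auto
    then have "fst a \<in> pverts G" "snd a \<in> pverts G"
      using assms(1) by auto
    then have "a = (x, y)"
      using a arc[OF a(1)] inj that by (auto simp: prod_eq_iff dest: inj_onD)
    then show "(x, y) \<in> parcs G"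
      using a by simp
  qed
  with inj eqs(1) show ?R
    by (auto simp: bij_betw_def)
next
  assume ?R
  then obtain \<phi> where bij: "bij_betw \<phi> (pverts G) (pverts H)"
    and arcs: "\<And>x y. x \<in> pverts G \<Longrightarrow> y \<in> pverts G \<Longrightarrow>
      (x, y) \<in> parcs G \<longleftrightarrow> (\<phi> x, \<phi> y) \<in> parcs H"
    by blast
  let ?k = "\<lparr> iso_verts = \<phi>, iso_arcs = map_prod \<phi> \<phi>, iso_head = snd, iso_tail = fst \<rparr>"
  have inj: "inj_on \<phi> (pverts G)" and im: "\<phi> ` pverts G = pverts H"
    using bij by (auto simp: bij_betw_def)
  have "wf_digraph (with_proj G)"
    using assms(1) by unfold_locales auto
  moreover have "inj_on (map_prod \<phi> \<phi>) (parcs G)"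
    using map_prod_inj_on[OF inj inj] assms(1) by (rule inj_on_subset)
  ultimately have "pre_digraph.digraph_isomorphism (with_proj G) ?k"
    using inj by (simp add: pre_digraph.digraph_isomorphism_def)
  moreover have "map_prod \<phi> \<phi> ` parcs G = parcs H"
  proof
    show "map_prod \<phi> \<phi> ` parcs G \<subseteq> parcs H"
      using assms(1) arcs by auto
    show "parcs H \<subseteq> map_prod \<phi> \<phi> ` parcs G"
    proof
      fix a assume a: "a \<in> parcs H"
      then have "fst a \<in> \<phi> ` pverts G" "snd a \<in> \<phi> ` pverts G"
        using assms(2) im by auto
      then obtain x y where xy: "x \<in> pverts G" "y \<in> pverts G" "a = (\<phi> x, \<phi> y)"
        by (elim imageE) (simp add: prod_eq_iff)
      then have "(x, y) \<in> parcs G"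
        using a arcs by simp
      then show "a \<in> map_prod \<phi> \<phi> ` parcs G"
        using xy(3) by force
    qed
  qed
  then have "with_proj H = app_iso ?k (with_proj G)"
    using im by (simp add: with_proj_def app_iso_def)
  ultimately show ?L
    unfolding digraph_iso_def by blast
qed

end

theory Submission
  imports Defs "HOL-Combinatorics.Transposition"
begin

text \<open>
  Up to isomorphism of synchronous graphs, \<open>f\<close> may be conjugated by any permutation \<open>\<pi>\<close> of
  the configurations, and the asynchronous graph of the conjugate has as many arcs as the sum of
  the Hamming distances between \<open>\<pi> x\<close> and \<open>\<pi> (f x)\<close>. If this sum does not depend on \<open>\<pi>\<close>, then
  in the multigraph of the edges \<open>{x, f x}\<close> the multiplicities \<open>w\<close> satisfy
  \<open>w a c + w b d = w a d + w b c\<close> for distinct vertices. A multigraph with at most as many edges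
  as vertices can do so only if it is edgeless or a star, which leaves, besides the identity and
  the constants, only the functions with \<open>a \<mapsto> b\<close>, \<open>b \<mapsto> b\<close> and \<open>c \<mapsto> a\<close> for all other \<open>c\<close>. For
  these \<open>b\<close> is the unique sink of the asynchronous graph, and its in-degree is \<open>n\<close> exactly when
  \<open>a\<close> and \<open>b\<close> are adjacent in the hypercube; conjugation can change whether they are.
\<close>

section \<open>Isomorphisms of synchronous and asynchronous graphs\<close>

lemma sync_equiv_conjugate:
  fixes f :: "('n::finite) config \<Rightarrow> 'n config"
  assumes "bij \<pi>"
  shows "\<pi> \<circ> f \<circ> inv \<pi> \<sim>\<^sub>S f"
proof -
  have "bij (inv \<pi>)"
    using assms by (rule bij_imp_bij_inv)
  moreover have "y = \<pi> (f (inv \<pi> x)) \<longleftrightarrow> inv \<pi> y = f (inv \<pi> x)" for x y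
    using assms by (metis bij_inv_eq_iff)
  ultimately show ?thesis
    unfolding sync_equiv_def
    by (subst digraph_iso_with_proj_iff)
      (auto simp: sync_graph_def intro!: exI[of _ "inv \<pi>"])
qed

definition arc :: "('n config \<Rightarrow> 'n config) \<Rightarrow> ('n::finite) config \<Rightarrow> 'n config \<Rightarrow> bool" where
  "arc f x y \<longleftrightarrow> (\<exists>i. f x $ i \<noteq> x $ i \<and> y = x + axis i 1)"

lemma parcs_async_graph: "parcs (async_graph f) = {(x, y). arc f x y}"
  by (auto simp: async_graph_def arc_def)

lemma pverts_async_graph [simp]: "pverts (async_graph f) = UNIV"
  by (simp add: async_graph_def)

lemma async_iso_iff:
  "digraph_iso (with_proj (async_graph h)) (with_proj (async_graph f)) \<longleftrightarrow>
    (\<exists>\<phi>. bij \<phi> \<and> (\<forall>x y. arc h x y \<longleftrightarrow> arc f (\<phi> x) (\<phi> y)))"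
  by (subst digraph_iso_with_proj_iff) (auto simp: parcs_async_graph)

lemma axis_one_eq_iff [simp]: "axis i (1::bit) = axis j 1 \<longleftrightarrow> i = j"
  by (simp add: axis_eq_axis)

lemma bit_neq_iff: "(a::bit) \<noteq> b \<longleftrightarrow> a = b + 1"
  by (cases a; cases b) auto

section \<open>Hamming distances count the asynchronous arcs\<close>

definition hamming :: "('n::finite) config \<Rightarrow> 'n config \<Rightarrow> nat" where
  "hamming x y = card {i. x $ i \<noteq> y $ i}"

lemma hamming_commute: "hamming x y = hamming y x"
  by (simp add: hamming_def eq_commute)

text \<open>The arcs leaving \<open>x\<close> correspond to the coordinates in which
  \<open>x\<close> and \<open>f x\<close> differ.\<close>

lemma card_arcs_async:
  "card {(x, y). arc f x y} = (\<Sum>x\<in>UNIV. hamming x (f x))"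
proof -
  let ?S = "SIGMA x:UNIV. {i. x $ i \<noteq> f x $ i}"
  have "{(x, y). arc f x y} = (\<lambda>(x, i). (x, x + axis i 1)) ` ?S"
    by (force simp: arc_def)
  moreover have "inj_on (\<lambda>(x, i). (x, x + axis i (1::bit))) ?S"
    by (auto simp: inj_on_def)
  ultimately have "card {(x, y). arc f x y} = card ?S"
    by (simp add: card_image)
  then show ?thesis
    by (simp add: hamming_def)
qed

lemma async_iso_sum_hamming:
  assumes "digraph_iso (with_proj (async_graph h)) (with_proj (async_graph f))"
  shows "(\<Sum>x\<in>UNIV. hamming x (h x)) = (\<Sum>x\<in>UNIV. hamming x (f x))"
proof -
  obtain \<phi> where \<phi>: "bij \<phi>" "\<And>x y. arc h x y \<longleftrightarrow> arc f (\<phi> x) (\<phi> y)"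
    using assms unfolding async_iso_iff by blast
  have "{(x, y). arc f x y} = map_prod \<phi> \<phi> ` {(x, y). arc h x y}"
  proof -
    have "(x, y) \<in> map_prod \<phi> \<phi> ` {(x, y). arc h x y}" if "arc f x y" for x y
    proof -
      obtain x' y' where "x = \<phi> x'" "y = \<phi> y'"
        using \<phi>(1) by (metis bij_pointE)
      then show ?thesis
        using that \<phi>(2) by force
    qed
    then show ?thesis
      using \<phi>(2) by auto
  qed
  moreover have "inj_on (map_prod \<phi> \<phi>) A" for A
    using \<phi>(1) by (metis bij_def inj_on_subset map_prod_inj_on UNIV_Times_UNIV subset_UNIV)
  ultimately have "card {(x, y). arc f x y} = card {(x, y). arc h x y}"
    by (simp add: card_image)
  then show ?thesis
    by (simp add: card_arcs_async)
qed

text \<open>Reindexing by \<open>\<pi>\<close> keeps \<open>f\<close> fixed and only changes where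
  its edges are placed in the hypercube.\<close>

lemma sum_hamming_conjugate:
  assumes "bij \<pi>"
  shows "(\<Sum>x\<in>UNIV. hamming x ((\<pi> \<circ> f \<circ> inv \<pi>) x)) = (\<Sum>x\<in>UNIV. hamming (\<pi> x) (\<pi> (f x)))"
  using sum.reindex_bij_betw[OF assms, of "\<lambda>x. hamming x ((\<pi> \<circ> f \<circ> inv \<pi>) x)"] assms
  by (simp add: bij_is_inj)

section \<open>Functions whose conjugates all have equally many asynchronous arcs\<close>

text \<open>For distinct vertices this is the multiplicity of an edge; a 2-cycle of \<open>f\<close>
  counts as a double edge.\<close>

definition edge_mult :: "('a \<Rightarrow> 'a) \<Rightarrow> 'a \<Rightarrow> 'a \<Rightarrow> int" where
  "edge_mult f u v = of_bool (f u = v) + of_bool (f v = u)"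

lemma bij_extending_4:
  fixes a b c d p q r s :: "'a::finite"
  assumes "distinct [a, b, c, d]" "distinct [p, q, r, s]"
  obtains \<pi> where "bij \<pi>" "\<pi> a = p" "\<pi> b = q" "\<pi> c = r" "\<pi> d = s"
proof -
  have "card (- {a, b, c, d}) = card (- {p, q, r, s})"
    using assms by (simp add: Compl_eq_Diff_UNIV card_Diff_subset)
  then obtain \<rho> where \<rho>: "bij_betw \<rho> (- {a, b, c, d}) (- {p, q, r, s})"
    using finite_same_card_bij[OF finite finite] by blast
  let ?\<pi> = "\<rho>(a := p, b := q, c := r, d := s)"
  have "bij_betw ?\<pi> {a, b, c, d} {p, q, r, s}"
    using assms by (auto simp: bij_betw_def inj_on_def)
  moreover have "bij_betw ?\<pi> (- {a, b, c, d}) (- {p, q, r, s})"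
    using \<rho> by (subst bij_betw_cong[of _ _ \<rho>]) auto
  ultimately have "bij_betw ?\<pi> ({a, b, c, d} \<union> - {a, b, c, d}) ({p, q, r, s} \<union> - {p, q, r, s})"
    by (rule bij_betw_combine) auto
  then have "bij ?\<pi>"
    by (simp only: Compl_partition)
  then show ?thesis
    using assms by (intro that[of ?\<pi>]) auto
qed

text \<open>The identity comes from the second difference of the distance sum with respect to the
  transpositions \<open>(a b)\<close> and \<open>(c d)\<close>: every pair cancels in it, except the pairs
  between \<open>{a, b}\<close> and \<open>{c, d}\<close>, which sit on a square of the hypercube.\<close>

lemma edge_mult_exchange:
  fixes f :: "('n::finite) config \<Rightarrow> 'n config"
  assumes card: "CARD('n) \<ge> 2"
    and const: "\<And>\<pi> :: 'n config \<Rightarrow> 'n config. bij \<pi> \<Longrightarrow> (\<Sum>x\<in>UNIV. hamming (\<pi> x) (\<pi> (f x))) = D"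
    and dist: "distinct [a, b, c, d]"
  shows "edge_mult f a c + edge_mult f b d = edge_mult f a d + edge_mult f b c"
proof -
  obtain i j :: 'n where "i \<noteq> j"
    using card card_le_Suc0_iff_eq[of "UNIV :: 'n set"] by auto
  \<comment> \<open>The corners of a square, ordered so that \<open>a c\<close> and
    \<open>b d\<close> become sides and \<open>a d\<close> and \<open>b c\<close> diagonals.\<close>
  let ?p = "0 :: 'n config" and ?q = "axis i 1 :: 'n config" and ?r = "axis j 1 :: 'n config"
  let ?s = "?q + ?r"
  have nth: "axis k (1::bit) $ l = of_bool (k = l)" for k l :: 'n
    by (auto simp: axis_def)
  have sets: "{k. ?p $ k \<noteq> ?r $ k} = {j}" "{k. ?q $ k \<noteq> ?s $ k} = {j}"
    "{k. ?p $ k \<noteq> ?s $ k} = {i, j}" "{k. ?q $ k \<noteq> ?r $ k} = {i, j}"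
    using \<open>i \<noteq> j\<close> by (auto simp: nth)
  have "distinct [?p, ?q, ?r, ?s]"
    using \<open>i \<noteq> j\<close> by (auto simp: vec_eq_iff nth)
  with dist obtain \<pi> where \<pi>: "bij \<pi>" "\<pi> a = ?p" "\<pi> b = ?q" "\<pi> c = ?r" "\<pi> d = ?s"
    by (rule bij_extending_4)
  have ham: "hamming (\<pi> a) (\<pi> c) = 1" "hamming (\<pi> b) (\<pi> d) = 1"
    "hamming (\<pi> a) (\<pi> d) = 2" "hamming (\<pi> b) (\<pi> c) = 2"
    using \<open>i \<noteq> j\<close> unfolding hamming_def \<pi>(2-) sets by simp_all
  let ?\<tau> = "transpose a b" and ?\<sigma> = "transpose c d"
  define H where "H \<rho> u v = int (hamming (\<rho> u) (\<rho> v))"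
    for \<rho> :: "'n config \<Rightarrow> 'n config" and u v
  define E where "E u v = H \<pi> u v - H (\<pi> \<circ> ?\<tau>) u v - H (\<pi> \<circ> ?\<sigma>) u v + H (\<pi> \<circ> ?\<tau> \<circ> ?\<sigma>) u v" for u v
  have D: "(\<Sum>x\<in>UNIV. H \<rho> x (f x)) = int D" if "bij \<rho>" for \<rho> :: "'n config \<Rightarrow> 'n config"
    unfolding H_def using const[OF that] by (metis of_nat_sum)
  have "bij (\<pi> \<circ> ?\<tau>)" "bij (\<pi> \<circ> ?\<sigma>)" "bij (\<pi> \<circ> ?\<tau> \<circ> ?\<sigma>)"
    using \<pi>(1) by (auto intro!: bij_comp)
  then have "(\<Sum>x\<in>UNIV. E x (f x)) = 0"
    using \<pi>(1) by (simp add: E_def sum.distrib sum_subtractf D)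
  \<comment> \<open>Both transpositions fix \<open>u\<close>, and at most one moves
    \<open>v\<close>, so the four terms cancel in pairs.\<close>
  moreover have E_out: "E u v = 0" if "u \<notin> {a, b, c, d}" for u v
    using that dist by (auto simp: E_def H_def transpose_def)
  have "(\<Sum>x\<in>UNIV. E x (f x)) = (\<Sum>x\<in>{a, b, c, d}. E x (f x))"
    using E_out by (intro sum.mono_neutral_right) auto
  \<comment> \<open>A side gives 1 - 2 - 2 + 1 = -2, a diagonal 2 - 1 - 1 + 2 = 2; all other pairs
    cancel.\<close>
  moreover have
    "E a v = 2 * (of_bool (v = d) - of_bool (v = c))"
    "E b v = 2 * (of_bool (v = c) - of_bool (v = d))"
    "E c v = 2 * (of_bool (v = b) - of_bool (v = a))"
    "E d v = 2 * (of_bool (v = a) - of_bool (v = b))" for v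
    using dist ham
    by (auto simp: E_def H_def transpose_def hamming_commute[of "\<pi> c" "\<pi> a"]
        hamming_commute[of "\<pi> c" "\<pi> b"] hamming_commute[of "\<pi> d" "\<pi> a"]
        hamming_commute[of "\<pi> d" "\<pi> b"] hamming_commute[of "\<pi> b" "\<pi> a"]
        hamming_commute[of "\<pi> d" "\<pi> c"])
  ultimately show ?thesis
    using dist by (auto simp: edge_mult_def)
qed

section \<open>From the exchange identity to a star\<close>

lemma ex_not_in_list:
  assumes "length xs < CARD('a::finite)"
  shows "\<exists>x::'a. x \<notin> set xs"
  using assms by (metis UNIV_eq_I card_length leD)

lemma ex_in_set_not_in_list:
  assumes "length xs < card A"
  shows "\<exists>x\<in>A. x \<notin> set xs"
  using assms by (metis List.finite_set card_length card_mono le_trans leD subsetI)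

text \<open>The edges form a star with centre \<open>a\<close>, as for a constant function, but the
  loop lies at the leaf \<open>b\<close> rather than at the centre.\<close>

definition near_constant :: "('a \<Rightarrow> 'a) \<Rightarrow> 'a \<Rightarrow> 'a \<Rightarrow> bool" where
  "near_constant f a b \<longleftrightarrow> a \<noteq> b \<and> f a = b \<and> f b = b \<and> (\<forall>c. c \<noteq> a \<longrightarrow> c \<noteq> b \<longrightarrow> f c = a)"

text \<open>A single edge forces a vertex with many preimages, and this hub must then be adjacent to
  all others. As \<open>f\<close> has one value per point, only the value at the image of the hub
  remains open.\<close>

lemma near_constant_if_edge_mult_exchange:
  fixes f :: "'a::finite \<Rightarrow> 'a"
  assumes card: "CARD('a) \<ge> 8"
    and nonconst: "\<not> (\<exists>c. \<forall>x. f x = c)"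
    and nonid: "f \<noteq> id"
    and exch: "\<And>a b c d. distinct [a, b, c, d] \<Longrightarrow>
      edge_mult f a c + edge_mult f b d = edge_mult f a d + edge_mult f b c"
  shows "\<exists>a b. near_constant f a b"
proof -
  have nonneg: "edge_mult f u v \<ge> 0" for u v
    by (simp add: edge_mult_def)
  have pos: "edge_mult f u v \<ge> 1 \<longleftrightarrow> f u = v \<or> f v = u" for u v
    by (simp add: edge_mult_def)
  have zero: "edge_mult f u v = 0 \<longleftrightarrow> f u \<noteq> v \<and> f v \<noteq> u" for u v
    by (simp add: edge_mult_def)
  obtain x where x: "f x \<noteq> x"
    using nonid by (auto simp: fun_eq_iff)
  define y where "y = f x"
  have yx: "y \<noteq> x"
    using x y_def by simp
  \<comment> \<open>The edge \<open>x y\<close> has to be balanced by an edge \<open>x d\<close> or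
    \<open>c y\<close>; as \<open>f x = y\<close>, the former can only come from
    \<open>f d = x\<close>.\<close>
  have dich: "f d = x \<or> f c = y \<or> f y = c" if "distinct [x, y, c, d]" for c d
  proof -
    have "edge_mult f x y + edge_mult f c d = edge_mult f x d + edge_mult f c y"
      using that by (intro exch) auto
    moreover have "edge_mult f x y \<ge> 1"
      by (simp add: pos y_def)
    ultimately have "edge_mult f x d \<ge> 1 \<or> edge_mult f c y \<ge> 1"
      using nonneg[of c d] by linarith
    then show ?thesis
      using that by (auto simp: pos y_def)
  qed
  \<comment> \<open>Either some \<open>d\<close> is not sent to \<open>x\<close>, and
    \<open>dich\<close> sends all but at most four vertices to \<open>y\<close>, or all but
    \<open>x\<close> and \<open>y\<close> go to \<open>x\<close>. Four preimages leave one outside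
    any three vertices.\<close>
  obtain z where z: "card {c. c \<noteq> z \<and> f c = z} \<ge> 4"
  proof -
    have card_minus: "4 \<le> card P" if "- set xs \<subseteq> P" "length xs \<le> 4" for xs and P :: "'a set"
    proof -
      have "card (- set xs) \<ge> 4"
        using card that(2) card_length[of xs] by (simp add: Compl_eq_Diff_UNIV card_Diff_subset)
      then show ?thesis
        using that(1) by (meson card_mono finite le_trans)
    qed
    show thesis
    proof (cases "\<exists>d. d \<noteq> x \<and> d \<noteq> y \<and> f d \<noteq> x")
      case True
      then obtain d where d: "d \<noteq> x" "d \<noteq> y" "f d \<noteq> x"
        by blast
      have "- set [x, y, d, f y] \<subseteq> {c. c \<noteq> y \<and> f c = y}"
        using dich[of _ d] d yx by fastforce
      then have "4 \<le> card {c. c \<noteq> y \<and> f c = y}"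
        by (rule card_minus) simp
      then show ?thesis
        by (rule that)
    next
      case False
      then have "- set [x, y] \<subseteq> {c. c \<noteq> x \<and> f c = x}"
        by auto
      then have "4 \<le> card {c. c \<noteq> x \<and> f c = x}"
        by (rule card_minus) simp
      then show ?thesis
        by (rule that)
    qed
  qed
  have hub: "f v = z \<or> f z = v" if "v \<noteq> z" for v
  proof -
    obtain u where u: "u \<noteq> z" "u \<noteq> v"
      using ex_not_in_list[of "[z, v]"] card by auto
    \<comment> \<open>This \<open>c\<close> is not adjacent to \<open>u\<close>, so the edge
      \<open>z c\<close> can only be balanced by an edge \<open>z v\<close>.\<close>
    obtain c where c: "c \<noteq> z" "f c = z" "c \<noteq> u" "c \<noteq> v" "c \<noteq> f u"
      using ex_in_set_not_in_list[of "[u, v, f u]" "{c. c \<noteq> z \<and> f c = z}"] z by auto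
    have "edge_mult f z c + edge_mult f u v = edge_mult f z v + edge_mult f u c"
      using that u c by (intro exch) auto
    moreover have "edge_mult f z c \<ge> 1" "edge_mult f u c = 0"
      using c u by (auto simp: pos zero)
    ultimately have "edge_mult f z v \<ge> 1"
      using nonneg[of u v] by linarith
    then show ?thesis
      by (auto simp: pos)
  qed
  define b where "b = f z"
  \<comment> \<open>If the hub were a fixed point, all vertices would map to it.\<close>
  have bz: "b \<noteq> z"
    using nonconst hub b_def by metis
  have leaf: "f v = z" if "v \<noteq> z" "v \<noteq> b" for v
    using hub that b_def by blast
  have no_edge: "f b \<noteq> u" if "u \<noteq> z" "u \<noteq> b" for u
  proof
    assume fb: "f b = u"
    obtain c where c: "c \<noteq> z" "c \<noteq> b" "c \<noteq> u"
      using ex_not_in_list[of "[z, b, u]"] card by auto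
    \<comment> \<open>With \<open>f b = u\<close> the identity would read 1 + 1 = 1 + 0.\<close>
    have "edge_mult f z c + edge_mult f b u = edge_mult f z u + edge_mult f b c"
      using that c bz by (intro exch) auto
    then show False
      using leaf[of c] leaf[of u] c that bz fb b_def by (auto simp: edge_mult_def)
  qed
  have "f b \<noteq> z"
  proof
    assume fb: "f b = z"
    obtain u where u: "u \<noteq> z" "u \<noteq> b"
      using ex_not_in_list[of "[z, b]"] card by auto
    obtain c where c: "c \<noteq> z" "c \<noteq> b" "c \<noteq> u"
      using ex_not_in_list[of "[z, b, u]"] card by auto
    \<comment> \<open>Now \<open>z b\<close> would be a double edge, and the identity would read 2 +
      0 = 1 + 0.\<close>
    have "edge_mult f z b + edge_mult f u c = edge_mult f z c + edge_mult f u b"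
      using u c bz by (intro exch) auto
    then show False
      using leaf[of c] leaf[of u] c u bz fb b_def by (auto simp: edge_mult_def)
  qed
  then have "f b = b"
    using no_edge by blast
  then have "near_constant f z b"
    using bz leaf b_def by (simp add: near_constant_def)
  then show ?thesis
    by blast
qed

section \<open>The exceptional functions\<close>

lemma near_constant_conjugate:
  fixes \<pi> :: "'a \<Rightarrow> 'a"
  assumes "near_constant f a b" "bij \<pi>"
  shows "near_constant (\<pi> \<circ> f \<circ> inv \<pi>) (\<pi> a) (\<pi> b)"
proof -
  have "inv \<pi> (\<pi> x) = x" and "\<pi> (inv \<pi> x) = x" for x
    using assms(2) by (simp_all add: bij_is_inj bij_is_surj surj_f_inv_f)
  then show ?thesis
    using assms(1) unfolding near_constant_def o_def by metis
qed

text \<open>Sinks are the fixed points of \<open>f\<close>, so an isomorphism between two such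
  graphs must match their points \<open>b\<close>.\<close>

lemma near_constant_sink_iff:
  assumes "near_constant f a b"
  shows "(\<forall>y. \<not> arc f x y) \<longleftrightarrow> x = b"
proof -
  have "(\<forall>y. \<not> arc f x y) \<longleftrightarrow> f x = x"
    unfolding arc_def by (metis vec_eq_iff)
  then show ?thesis
    using assms unfolding near_constant_def by metis
qed

text \<open>A neighbour of \<open>b\<close> other than \<open>a\<close> is mapped to
  \<open>a\<close>, so it has an arc to \<open>b\<close> exactly when \<open>a\<close> and
  \<open>b\<close> agree in its direction; \<open>a\<close> itself is mapped to \<open>b\<close>.
  Hence no arc is missing just when \<open>a\<close> and \<open>b\<close> differ in a single
  coordinate.\<close>

lemma near_constant_in_degree:
  fixes f :: "('n::finite) config \<Rightarrow> 'n config"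
  assumes f: "near_constant f a b"
  shows "card {x. arc f x b} = CARD('n) \<longleftrightarrow> (\<exists>i. b = a + axis i 1)"
proof -
  let ?nb = "(\<lambda>i. b + axis i 1) ` UNIV"
  have two: "x + axis i 1 + axis i 1 = x" for x :: "'n config" and i
    by (simp add: vec_eq_iff add.assoc)
  have arc_iff: "arc f x b \<longleftrightarrow> (\<exists>i. x = b + axis i 1 \<and> f x $ i \<noteq> x $ i)" for x
    unfolding arc_def using two by metis
  have card_nb: "card ?nb = CARD('n)"
    by (simp add: card_image inj_on_def)
  have "card {x. arc f x b} = CARD('n) \<longleftrightarrow> {x. arc f x b} = ?nb"
    using card_nb card_subset_eq[of ?nb "{x. arc f x b}"] by (auto simp: arc_iff)
  also have "\<dots> \<longleftrightarrow> (\<forall>i. arc f (b + axis i 1) b)"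
    using arc_iff by blast
  also have "\<dots> \<longleftrightarrow> (\<forall>i. f (b + axis i 1) $ i \<noteq> (b + axis i 1) $ i)"
    unfolding arc_iff by (simp only: add_left_cancel axis_one_eq_iff) simp
  also have "\<dots> \<longleftrightarrow> (\<exists>i. b = a + axis i 1)"
  proof
    assume all: "\<forall>i. f (b + axis i 1) $ i \<noteq> (b + axis i 1) $ i"
    obtain i where i: "a $ i \<noteq> b $ i"
      using f by (auto simp: near_constant_def vec_eq_iff)
    show "\<exists>i. b = a + axis i 1"
    proof (rule ccontr)
      assume na: "\<nexists>i. b = a + axis i 1"
      then have "b + axis i 1 \<noteq> a"
        using two by metis
      moreover have "b + axis i 1 \<noteq> b"
        by (auto simp: vec_eq_iff axis_def)
      ultimately have "f (b + axis i 1) = a"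
        using f by (simp add: near_constant_def)
      moreover have "(b + axis i 1) $ i = a $ i"
        using i by (simp add: axis_nth bit_neq_iff)
      ultimately show False
        using all by metis
    qed
  next
    assume "\<exists>i. b = a + axis i 1"
    then obtain j where j: "b = a + axis j 1"
      by blast
    show "\<forall>i. f (b + axis i 1) $ i \<noteq> (b + axis i 1) $ i"
    proof
      fix i
      show "f (b + axis i 1) $ i \<noteq> (b + axis i 1) $ i"
      proof (cases "i = j")
        case True
        then have "b + axis i 1 = a"
          unfolding j by (simp only: two)
        moreover have "b $ i \<noteq> a $ i"
          using True j by (simp add: axis_nth)
        ultimately show ?thesis
          using f by (simp add: near_constant_def)
      next
        case False
        have "(b + axis i 1) $ i = a $ i + 1" "(b + axis i 1) $ i = b $ i + 1"
          using False by (simp_all add: j axis_def)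
        then have neq: "(b + axis i 1) $ i \<noteq> a $ i" "(b + axis i 1) $ i \<noteq> b $ i"
          by (simp_all only: bit_neq_iff)
        then have "f (b + axis i 1) = a"
          using f unfolding near_constant_def by metis
        then show ?thesis
          using neq by metis
      qed
    qed
  qed
  finally show ?thesis .
qed

lemma near_constant_async_iso:
  fixes f h :: "('n::finite) config \<Rightarrow> 'n config"
  assumes h: "near_constant h a' b'" and f: "near_constant f a b"
    and iso: "digraph_iso (with_proj (async_graph h)) (with_proj (async_graph f))"
  shows "(\<exists>i. b' = a' + axis i 1) \<longleftrightarrow> (\<exists>i. b = a + axis i 1)"
proof -
  obtain \<phi> where \<phi>: "bij \<phi>" "\<And>x y. arc h x y \<longleftrightarrow> arc f (\<phi> x) (\<phi> y)"
    using iso unfolding async_iso_iff by blast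
  have "\<forall>y. \<not> arc f (\<phi> b') y"
    using near_constant_sink_iff[OF h, of b'] \<phi> by (metis bij_pointE)
  then have b: "\<phi> b' = b"
    using near_constant_sink_iff[OF f] by blast
  have "{x. arc h x b'} = \<phi> -` {x. arc f x b}"
    using \<phi>(2) b by auto
  then have "card {x. arc h x b'} = card {x. arc f x b}"
    using card_vimage_inj[of \<phi> "{x. arc f x b}"] \<phi>(1) by (simp add: bij_is_inj bij_is_surj)
  then show ?thesis
    using near_constant_in_degree[OF h] near_constant_in_degree[OF f] by simp
qed

lemma near_constant_ex_not_async_iso:
  fixes f :: "('n::finite) config \<Rightarrow> 'n config"
  assumes card: "CARD('n) \<ge> 2" and f: "near_constant f a b"
  shows "\<exists>\<pi> :: 'n config \<Rightarrow> 'n config. bij \<pi> \<and>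
    \<not> digraph_iso (with_proj (async_graph (\<pi> \<circ> f \<circ> inv \<pi>))) (with_proj (async_graph f))"
proof -
  obtain i j :: 'n where ij: "i \<noteq> j"
    using card card_le_Suc0_iff_eq[of "UNIV :: 'n set"] by auto
  \<comment> \<open>The witness lies at distance two from \<open>a\<close> if \<open>b\<close> is a
    neighbour of \<open>a\<close>, and is a neighbour of \<open>a\<close> otherwise.\<close>
  have "\<exists>b'. b' \<noteq> a \<and> ((\<exists>i. b' = a + axis i 1) \<longleftrightarrow> \<not> (\<exists>i. b = a + axis i 1))"
  proof (cases "\<exists>i. b = a + axis i 1")
    case True
    have "axis i 1 + axis j 1 \<noteq> (0 :: 'n config)"
      using ij by (auto simp: vec_eq_iff axis_def)
    moreover have "axis i 1 + axis j 1 \<noteq> (axis k 1 :: 'n config)" for k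
    proof (cases "k = i")
      case True
      then show ?thesis
        by (simp add: vec_eq_iff axis_def)
    next
      case False
      then show ?thesis
        using ij by (auto simp: vec_eq_iff axis_def)
    qed
    ultimately show ?thesis
      using True by (intro exI[of _ "a + (axis i 1 + axis j 1)"]) auto
  next
    case False
    have "a + axis i 1 \<noteq> a"
      by (auto simp: vec_eq_iff axis_def)
    with False show ?thesis
      by blast
  qed
  then obtain b' where b': "b' \<noteq> a"
    "(\<exists>i. b' = a + axis i 1) \<longleftrightarrow> \<not> (\<exists>i. b = a + axis i 1)"
    by blast
  \<comment> \<open>As \<open>b\<close> and \<open>b'\<close> both differ from \<open>a\<close>,
    conjugation keeps the centre \<open>a\<close> and moves the sink to \<open>b'\<close>.\<close>
  let ?\<pi> = "transpose b b'"
  have "?\<pi> a = a" "?\<pi> b = b'"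
    using b' f by (auto simp: near_constant_def transpose_def)
  then have "near_constant (?\<pi> \<circ> f \<circ> inv ?\<pi>) a b'"
    using near_constant_conjugate[OF f, of ?\<pi>] by (metis bij_transpose)
  then have "\<not> digraph_iso (with_proj (async_graph (?\<pi> \<circ> f \<circ> inv ?\<pi>))) (with_proj (async_graph f))"
    using near_constant_async_iso[OF _ f] b'(2) by blast
  then show ?thesis
    by (intro exI[of _ ?\<pi>] conjI bij_transpose)
qed

lemma card_bit: "CARD(bit) = 2"
proof -
  have "(UNIV :: bit set) = {0, 1}"
    using bit_not_zero_iff by blast
  moreover have "card {0, 1 :: bit} = 2"
    by simp
  ultimately show ?thesis
    by metis
qed

theorem theorem2:
  fixes f :: "('n::finite) config \<Rightarrow> 'n config"
  assumes "CARD('n) \<ge> 3"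
    and "\<not> (\<exists>c. \<forall>x. f x = c)"
    and "f \<noteq> id"
  shows "\<exists>h :: 'n config \<Rightarrow> 'n config.
    h \<sim>\<^sub>S f \<and> \<not> digraph_iso (with_proj (async_graph h)) (with_proj (async_graph f))"
proof (rule ccontr)
  assume contra: "\<not> ?thesis"
  have iso: "digraph_iso (with_proj (async_graph (\<pi> \<circ> f \<circ> inv \<pi>))) (with_proj (async_graph f))"
    if "bij \<pi>" for \<pi> :: "'n config \<Rightarrow> 'n config"
    using contra sync_equiv_conjugate[OF that] by blast
  have const: "(\<Sum>x\<in>UNIV. hamming (\<pi> x) (\<pi> (f x))) = (\<Sum>x\<in>UNIV. hamming x (f x))"
    if "bij \<pi>" for \<pi> :: "'n config \<Rightarrow> 'n config"
    using async_iso_sum_hamming[OF iso[OF that]] sum_hamming_conjugate[OF that] by metis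
  \<comment> \<open>The bound 2^3 is the one used for finding the hub.\<close>
  have "CARD('n config) \<ge> 8"
    using power_increasing[OF assms(1), of "2::nat"] by (simp add: card_bit)
  moreover have "edge_mult f a c + edge_mult f b d = edge_mult f a d + edge_mult f b c"
    if "distinct [a, b, c, d]" for a b c d
    using assms(1) const that by (intro edge_mult_exchange) auto
  ultimately obtain a b where "near_constant f a b"
    using near_constant_if_edge_mult_exchange assms(2,3) by blast
  then show False
    using near_constant_ex_not_async_iso[of f a b] assms(1) iso by auto
qed

end
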